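(* Let $I\subseteq\mathbb{R}$ be a proper interval. A function $F\colon I^2\to I$ is a quasi-arithmetic mean if and only if it is reflexive, partially strictly increasing, symmetric and bisymmetric.
   Context: A proper interval is an interval of $\mathbb{R}$ with at least two elements. A function $F\colon I^2\to I$ is called a quasi-arithmetic mean if there are a proper interval $J\subseteq\mathbb{R}$ and a continuous, strictly increasing bijection $f\colon J\to I$ such that $F(x,y)=f\left(\frac{f^{-1}(x)+f^{-1}(y)}{2}\right)$ for all $x,y\in I$. A map $F\colon I^2\to I$ is reflexive if $F(x,x)=x$ for every $x\in I$. It is partially strictly increasing if for every fixed $x_0,y_0\in I$ the functions $x\mapsto F(x,y_0)$ and $y\mapsto F(x_0,y)$ are strictly increasing on $I$. It is symmetric if $F(x,y)=F(y,x)$ for every $x,y\in I$. It is bisymmetric if $F\big(F(x,y),F(u,v)\big)=F\big(F(x,u),F(y,v)\big)$ for every $x,y,u,v\in I$. *)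

theory Defs
  imports "HOL-Analysis.Analysis"
begin

text \<open>A map from the square of \<open>I\<close> to \<open>I\<close> is a curried function \<open>F \<in> I \<rightarrow> I \<rightarrow> I\<close>; its values
  outside \<open>I\<close> are irrelevant, and every definition below only looks at arguments in \<open>I\<close>.\<close>

definition proper_interval :: "real set \<Rightarrow> bool" where
  "proper_interval I \<longleftrightarrow> is_interval I \<and> (\<exists>x\<in>I. \<exists>y\<in>I. x \<noteq> y)"

definition quasi_arithmetic_mean_on :: "real set \<Rightarrow> (real \<Rightarrow> real \<Rightarrow> real) \<Rightarrow> bool" where
  "quasi_arithmetic_mean_on I F \<longleftrightarrow>
     (\<exists>J f. proper_interval J \<and> continuous_on J f \<and> strict_mono_on J f \<and> bij_betw f J I \<and>
        (\<forall>x\<in>I. \<forall>y\<in>I. F x y = f ((inv_into J f x + inv_into J f y) / 2)))"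

definition reflexive_map_on :: "real set \<Rightarrow> (real \<Rightarrow> real \<Rightarrow> real) \<Rightarrow> bool" where
  "reflexive_map_on I F \<longleftrightarrow> (\<forall>x\<in>I. F x x = x)"

definition partially_strictly_increasing_on :: "real set \<Rightarrow> (real \<Rightarrow> real \<Rightarrow> real) \<Rightarrow> bool" where
  "partially_strictly_increasing_on I F \<longleftrightarrow>
     (\<forall>x0\<in>I. \<forall>y0\<in>I. strict_mono_on I (\<lambda>x. F x y0) \<and> strict_mono_on I (\<lambda>y. F x0 y))"

definition symmetric_map_on :: "real set \<Rightarrow> (real \<Rightarrow> real \<Rightarrow> real) \<Rightarrow> bool" where
  "symmetric_map_on I F \<longleftrightarrow> (\<forall>x\<in>I. \<forall>y\<in>I. F x y = F y x)"

definition bisymmetric_map_on :: "real set \<Rightarrow> (real \<Rightarrow> real \<Rightarrow> real) \<Rightarrow> bool" where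
  "bisymmetric_map_on I F \<longleftrightarrow>
     (\<forall>x\<in>I. \<forall>y\<in>I. \<forall>u\<in>I. \<forall>v\<in>I. F (F x y) (F u v) = F (F x u) (F y v))"

end

theory Submission
  imports Defs
begin

text \<open>On a segment \<open>[a, b]\<close> the mean generates a dyadic net whose order type is that of the dyadic
  rationals, and hence a monotone surjection \<open>\<psi>\<close> onto \<open>[0, 1]\<close> that turns \<open>F\<close> into the arithmetic mean.
  No continuity is needed to see that \<open>\<psi>\<close> is injective: if \<open>\<psi> u = \<psi> v\<close> for some \<open>u < v\<close>, then \<open>\<psi>\<close> is
  constant on each of the nondegenerate segments \<open>[F u z, F v z]\<close>, with value \<open>(\<psi> u + \<psi> z) / 2\<close>.
  As each segment contains a rational, \<open>\<psi>\<close> would take only countably many values.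
  Such a \<open>\<psi>\<close> is unique up to affine maps, so those of different segments can be glued.\<close>

section \<open>Auxiliary facts about real numbers and monotone functions\<close>

lemma is_interval_midpoint:
  fixes J :: "real set"
  assumes "is_interval J" "s \<in> J" "t \<in> J"
  shows "(s + t) / 2 \<in> J"
  using convexD[OF is_interval_convex[OF assms(1)] assms(2,3), of "1/2" "1/2"]
  by (simp add: add_divide_distrib)

text \<open>Ends each squeezing argument below, where two numbers share a cell of length
  \<open>1 / 2 ^ n\<close> at every level \<open>n\<close>.\<close>

lemma eq_if_dyadically_close:
  fixes s t c :: real
  assumes "\<And>n. \<bar>s - t\<bar> \<le> c / 2 ^ n"
  shows "s = t"
proof -
  have "(\<lambda>n. c / 2 ^ n) \<longlonglongrightarrow> 0"
    by (rule LIMSEQ_divide_realpow_zero) simp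
  then have "\<bar>s - t\<bar> \<le> 0"
    by (rule LIMSEQ_le_const) (use assms in blast)
  then show ?thesis by simp
qed

text \<open>A monotone function can only be discontinuous by a jump, and a jump would leave a gap in
  the image. This supplies the continuity of the generator at the end.\<close>

lemma strict_mono_on_interval_image_continuous:
  fixes f :: "real \<Rightarrow> real"
  assumes "strict_mono_on J f" "is_interval (f ` J)"
  shows "continuous_on J f"
  unfolding continuous_on_def
proof (intro ballI order_tendstoI)
  fix s l assume s: "s \<in> J" and l: "l < f s"
  show "\<forall>\<^sub>F t in at s within J. l < f t"
  proof (cases "l \<in> f ` J")
    case True
    then obtain r where r: "r \<in> J" "l = f r" by auto
    then have "r < s"
      using assms(1) s l strict_mono_on_less by blast
    then have "\<forall>\<^sub>F t in at s within J. r < t"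
      by (intro order_tendstoD(1)[OF tendsto_ident_at])
    moreover have "\<forall>\<^sub>F t in at s within J. t \<in> J"
      by (simp add: eventually_at_filter)
    ultimately show ?thesis
      by eventually_elim (use assms(1) r in \<open>auto simp: strict_mono_on_def\<close>)
  next
    case False
    \<comment> \<open>A value \<open>f t \<le> l\<close>, together with \<open>l < f s\<close>,
      would put \<open>l\<close> into the image.\<close>
    have "l < f t" if "t \<in> J" for t
      using mem_is_interval_1_I[OF assms(2), of "f t" "f s" l] False that s l by force
    then show ?thesis
      by (auto simp: eventually_at_filter)
  qed
next
  fix s l assume s: "s \<in> J" and l: "f s < l"
  show "\<forall>\<^sub>F t in at s within J. f t < l"
  proof (cases "l \<in> f ` J")
    case True
    then obtain r where r: "r \<in> J" "l = f r" by auto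
    then have "s < r"
      using assms(1) s l strict_mono_on_less by blast
    then have "\<forall>\<^sub>F t in at s within J. t < r"
      by (intro order_tendstoD(2)[OF tendsto_ident_at])
    moreover have "\<forall>\<^sub>F t in at s within J. t \<in> J"
      by (simp add: eventually_at_filter)
    ultimately show ?thesis
      by eventually_elim (use assms(1) r in \<open>auto simp: strict_mono_on_def\<close>)
  next
    case False
    have "f t < l" if "t \<in> J" for t
      using mem_is_interval_1_I[OF assms(2), of "f s" "f t" l] False that s l by force
    then show ?thesis
      by (auto simp: eventually_at_filter)
  qed
qed

section \<open>Quasi-arithmetic means have the four properties\<close>

text \<open>The inverse \<open>g\<close> of the generator conjugates \<open>F\<close> to the
  arithmetic mean on \<open>J\<close> (fact \<open>gF\<close>), so each property is inherited from
  that mean.\<close>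

lemma quasi_arithmetic_mean_on_properties:
  assumes "quasi_arithmetic_mean_on I F"
  shows "reflexive_map_on I F \<and> partially_strictly_increasing_on I F \<and>
    symmetric_map_on I F \<and> bisymmetric_map_on I F"
proof -
  obtain J f where J: "proper_interval J" and mono: "strict_mono_on J f"
    and bij: "bij_betw f J I"
    and F: "\<And>x y. x \<in> I \<Longrightarrow> y \<in> I \<Longrightarrow> F x y = f ((inv_into J f x + inv_into J f y) / 2)"
    using assms unfolding quasi_arithmetic_mean_on_def by blast
  define g where "g = inv_into J f"
  have g_in: "g x \<in> J" if "x \<in> I" for x
    using bij that unfolding g_def by (metis bij_betw_imp_surj_on inv_into_into)
  have fg: "f (g x) = x" if "x \<in> I" for x
    using bij that unfolding g_def by (metis bij_betw_inv_into_right)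
  have gf: "g (f s) = s" if "s \<in> J" for s
    using bij that unfolding g_def by (metis bij_betw_inv_into_left)
  have g_less: "g x < g y" if "x \<in> I" "y \<in> I" "x < y" for x y
    using strict_mono_on_less[OF mono g_in[OF that(1)] g_in[OF that(2)]] fg that by simp
  have mid: "(g x + g y) / 2 \<in> J" if "x \<in> I" "y \<in> I" for x y
    using J g_in that is_interval_midpoint unfolding proper_interval_def by blast
  have F_eq: "F x y = f ((g x + g y) / 2)" if "x \<in> I" "y \<in> I" for x y
    using F that unfolding g_def by blast
  have F_in: "F x y \<in> I" if "x \<in> I" "y \<in> I" for x y
    using F_eq mid that bij by (metis bij_betw_apply)
  have gF: "g (F x y) = (g x + g y) / 2" if "x \<in> I" "y \<in> I" for x y
    using F_eq gf mid that by simp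
  have "reflexive_map_on I F"
    unfolding reflexive_map_on_def by (simp add: F_eq fg)
  moreover have "symmetric_map_on I F"
    unfolding symmetric_map_on_def by (simp add: F_eq add.commute)
  moreover have "bisymmetric_map_on I F"
    unfolding bisymmetric_map_on_def by (simp add: F_eq[OF F_in F_in] gF algebra_simps add_divide_distrib)
  moreover have "partially_strictly_increasing_on I F"
    unfolding partially_strictly_increasing_on_def strict_mono_on_def
    by (auto simp: F_eq g_less mid intro!: strict_mono_onD[OF mono])
  ultimately show ?thesis by blast
qed

section \<open>Bisymmetric means and their linearizations\<close>

locale bisymmetric_mean =
  fixes I :: "real set" and F :: "real \<Rightarrow> real \<Rightarrow> real"
  assumes interval: "is_interval I"
    and F_in: "x \<in> I \<Longrightarrow> y \<in> I \<Longrightarrow> F x y \<in> I"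
    and F_refl: "x \<in> I \<Longrightarrow> F x x = x"
    and F_mono_left: "x \<in> I \<Longrightarrow> x' \<in> I \<Longrightarrow> y \<in> I \<Longrightarrow> x < x' \<Longrightarrow> F x y < F x' y"
    and F_sym: "x \<in> I \<Longrightarrow> y \<in> I \<Longrightarrow> F x y = F y x"
    and F_bisym: "x \<in> I \<Longrightarrow> y \<in> I \<Longrightarrow> u \<in> I \<Longrightarrow> v \<in> I \<Longrightarrow> F (F x y) (F u v) = F (F x u) (F y v)"
begin

lemma F_mono_right: "x \<in> I \<Longrightarrow> y \<in> I \<Longrightarrow> y' \<in> I \<Longrightarrow> y < y' \<Longrightarrow> F x y < F x y'"
  using F_mono_left F_sym by metis

lemma F_mono: "x \<in> I \<Longrightarrow> x' \<in> I \<Longrightarrow> y \<in> I \<Longrightarrow> y' \<in> I \<Longrightarrow> x \<le> x' \<Longrightarrow> y \<le> y' \<Longrightarrow> F x y \<le> F x' y'"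
  by (metis F_mono_left F_mono_right less_eq_real_def order_trans)

lemma segment_subset: "a \<in> I \<Longrightarrow> b \<in> I \<Longrightarrow> {a..b} \<subseteq> I"
  using mem_is_interval_1_I[OF interval] by (meson atLeastAtMost_iff subsetI)

text \<open>Reflexivity and monotonicity make \<open>F\<close> an internal mean, so every segment
  can be treated in isolation.\<close>

lemma F_in_segment:
  assumes "a \<in> I" "b \<in> I" "x \<in> {a..b}" "y \<in> {a..b}"
  shows "F x y \<in> {a..b}"
proof -
  have "x \<in> I" "y \<in> I"
    using assms segment_subset by blast+
  then have "F a a \<le> F x y" "F x y \<le> F b b"
    using assms by (auto intro!: F_mono)
  then show ?thesis
    using assms F_refl by simp
qed

text \<open>Such a \<open>\<phi>\<close> is a candidate for the inverse of the generator. The set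
  \<open>A\<close> is a parameter because linearizations are first built on segments and then glued
  to one on \<open>I\<close>.\<close>

definition linearizes_on :: "real set \<Rightarrow> (real \<Rightarrow> real) \<Rightarrow> bool" where
  "linearizes_on A \<phi> \<longleftrightarrow>
     strict_mono_on A \<phi> \<and> (\<forall>x\<in>A. \<forall>y\<in>A. \<phi> (F x y) = (\<phi> x + \<phi> y) / 2)"

lemma linearizes_on_less: "linearizes_on A \<phi> \<Longrightarrow> x \<in> A \<Longrightarrow> y \<in> A \<Longrightarrow> x < y \<Longrightarrow> \<phi> x < \<phi> y"
  unfolding linearizes_on_def by (auto dest: strict_mono_onD)

lemma linearizes_on_le: "linearizes_on A \<phi> \<Longrightarrow> x \<in> A \<Longrightarrow> y \<in> A \<Longrightarrow> x \<le> y \<Longrightarrow> \<phi> x \<le> \<phi> y"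
  using linearizes_on_less by (metis order_le_less)

lemma linearizes_on_F: "linearizes_on A \<phi> \<Longrightarrow> x \<in> A \<Longrightarrow> y \<in> A \<Longrightarrow> \<phi> (F x y) = (\<phi> x + \<phi> y) / 2"
  unfolding linearizes_on_def by blast

lemma linearizes_on_subset: "linearizes_on A \<phi> \<Longrightarrow> B \<subseteq> A \<Longrightarrow> linearizes_on B \<phi>"
  unfolding linearizes_on_def strict_mono_on_def by blast

end

section \<open>The dyadic net of a segment\<close>

locale bisymmetric_mean_segment = bisymmetric_mean +
  fixes a b :: real
  assumes a_in: "a \<in> I" and b_in: "b \<in> I" and a_less_b: "a < b"
begin

text \<open>\<open>net n k\<close> is the point that will get the coordinate \<open>k / 2 ^ n\<close>, for \<open>k \<le> 2 ^ n\<close>.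
  For even \<open>k\<close> the two arguments of \<open>F\<close> coincide.\<close>

primrec net :: "nat \<Rightarrow> nat \<Rightarrow> real" where
  "net 0 k = (if k = 0 then a else b)"
| "net (Suc n) k = F (net n (k div 2)) (net n (Suc k div 2))"

declare net.simps(2) [simp del]

lemma net_in_segment: "net n k \<in> {a..b}"
proof (induction n arbitrary: k)
  case 0
  then show ?case using a_less_b by simp
next
  case (Suc n)
  then show ?case unfolding net.simps(2) using F_in_segment a_in b_in by blast
qed

lemma net_in: "net n k \<in> I"
  using net_in_segment segment_subset a_in b_in by blast

lemma net_double: "net (Suc n) (2 * k) = net n k"
  by (simp add: net.simps(2) F_refl net_in)

text \<open>Points of one level survive in all finer levels, so points of different levels can be
  compared at a common one.\<close>

lemma net_refine: "net (n + m) (k * 2 ^ m) = net n k"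
proof (induction m)
  case (Suc m)
  then show ?case using net_double[of "n + m" "k * 2 ^ m"] by (simp add: ac_simps)
qed simp

lemma net_0: "net n 0 = a"
  using net_refine[of 0 n 0] by simp

lemma net_top: "net n (2 ^ n) = b"
  using net_refine[of 0 n 1] by simp

text \<open>This is where bisymmetry enters: on the net, \<open>F\<close> takes the midpoint of the
  coordinates. Each point is split into the pair that generates it, and bisymmetry regroups the two
  pairs so that the induction hypothesis applies to both inner means.\<close>

lemma F_net: "i \<le> 2 ^ n \<Longrightarrow> j \<le> 2 ^ n \<Longrightarrow> F (net n i) (net n j) = net (Suc n) (i + j)"
proof (induction n arbitrary: i j)
  case 0
  then show ?case using a_in b_in F_sym
    by (cases i; cases j) (auto simp: net.simps(2))
next
  case (Suc n)
  let ?i = "i div 2" and ?i' = "Suc i div 2" and ?j = "j div 2" and ?j' = "Suc j div 2"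
  have bounds: "?i \<le> 2 ^ n" "?i' \<le> 2 ^ n" "?j \<le> 2 ^ n" "?j' \<le> 2 ^ n"
    using Suc.prems by auto
  \<comment> \<open>The second pair is written in reversed order, so that a rounded-down half meets
    a rounded-up one. The index sums are then the two halves of \<open>i + j\<close>, even if both
    \<open>i\<close> and \<open>j\<close> are odd.\<close>
  have "F (net (Suc n) i) (net (Suc n) j)
      = F (F (net n ?i) (net n ?i')) (F (net n ?j') (net n ?j))"
    by (simp add: net.simps(2) F_sym net_in)
  also have "\<dots> = F (F (net n ?i) (net n ?j')) (F (net n ?i') (net n ?j))"
    by (simp add: F_bisym net_in)
  also have "\<dots> = F (net (Suc n) (?i + ?j')) (net (Suc n) (?i' + ?j))"
    using Suc.IH bounds by simp
  also have "\<dots> = F (net (Suc n) ((i + j) div 2)) (net (Suc n) (Suc (i + j) div 2))"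
  proof -
    have "?i + ?j' = (i + j) div 2 \<and> ?i' + ?j = Suc (i + j) div 2 \<or>
          ?i' + ?j = (i + j) div 2 \<and> ?i + ?j' = Suc (i + j) div 2"
      by (cases "even i"; cases "even j") (auto elim!: evenE oddE)
    then show ?thesis using F_sym net_in by metis
  qed
  also have "\<dots> = net (Suc (Suc n)) (i + j)"
    by (simp only: net.simps(2)[of "Suc n"])
  finally show ?case .
qed

text \<open>Of two neighbours at a new level, one is an old point and the other is its mean with an
  old neighbour.\<close>

lemma net_Suc_less: "k < 2 ^ n \<Longrightarrow> net n k < net n (Suc k)"
proof (induction n arbitrary: k)
  case 0
  then show ?case using a_less_b by simp
next
  case (Suc n)
  consider m where "k = 2 * m" | m where "k = 2 * m + 1" by (meson oddE evenE)
  then show ?case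
  proof cases
    case 1
    then have "net n m < net n (Suc m)" using Suc by simp
    then have "F (net n m) (net n m) < F (net n m) (net n (Suc m))"
      using F_mono_right net_in by blast
    then show ?thesis by (simp add: 1 net.simps(2))
  next
    case 2
    then have "net n m < net n (Suc m)" using Suc by simp
    then have "F (net n m) (net n (Suc m)) < F (net n (Suc m)) (net n (Suc m))"
      using F_mono_left net_in by blast
    then show ?thesis by (simp add: 2 net.simps(2))
  qed
qed

lemma net_less: "i < j \<Longrightarrow> j \<le> 2 ^ n \<Longrightarrow> net n i < net n j"
proof (induction j)
  case (Suc j)
  then show ?case using net_Suc_less[of j n]
    by (cases "i = j") auto
qed simp

text \<open>Both points are lifted to level \<open>n + m\<close>, where the net is strictly
  increasing in the index.\<close>

lemma net_le_imp_dyadic_le: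
  assumes "i \<le> 2 ^ n" "j \<le> 2 ^ m" "net n i \<le> net m j"
  shows "real i / 2 ^ n \<le> real j / 2 ^ m"
proof -
  have "net (n + m) (i * 2 ^ m) \<le> net (n + m) (j * 2 ^ n)"
    using assms(3) net_refine[of n m i] net_refine[of m n j] by (simp add: add.commute)
  moreover have "i * 2 ^ m \<le> 2 ^ (n + m)"
    using assms(1) by (simp add: power_add)
  ultimately have "i * 2 ^ m \<le> j * 2 ^ n"
    using net_less[of "j * 2 ^ n" "i * 2 ^ m" "n + m"] by linarith
  then have "real (i * 2 ^ m) \<le> real (j * 2 ^ n)"
    by (simp only: of_nat_le_iff)
  then show ?thesis by (simp add: field_simps)
qed

lemma net_bracket:
  assumes "x \<in> {a..b}"
  obtains k where "k < 2 ^ n" "net n k \<le> x" "x \<le> net n (Suc k)"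
proof (cases "x = b")
  case True
  have "net n (Suc (2 ^ n - 1)) = b" using net_top by simp
  then show ?thesis using that[of "2 ^ n - 1"] True net_in_segment by auto
next
  case False
  \<comment> \<open>The cell ends at the least index whose point is at least \<open>x\<close>; this
    index is 0 only for \<open>x = a\<close>, which lies in the first cell.\<close>
  let ?P = "\<lambda>k. x \<le> net n k"
  have P: "?P (2 ^ n)" using net_top assms by simp
  show ?thesis
  proof (cases "LEAST k. ?P k")
    case 0
    then have "x \<le> a" using LeastI[of ?P, OF P] net_0 by simp
    then show ?thesis using that[of 0] assms net_in_segment net_0 by auto
  next
    case (Suc k)
    have "x \<le> net n (Suc k)" using LeastI[of ?P, OF P] Suc by simp
    moreover have "Suc k \<le> 2 ^ n" using Least_le[of ?P, OF P] Suc by simp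
    moreover have "\<not> ?P k" using not_less_Least[of k ?P] Suc by simp
    ultimately show ?thesis using that[of k] by simp
  qed
qed

section \<open>Uniqueness of linearizations up to affine maps\<close>

text \<open>The net is generated from \<open>a\<close> and \<open>b\<close> by \<open>F\<close>, so
  the values at these two points determine all others on it.\<close>

lemma linearizes_on_net:
  assumes "linearizes_on {a..b} \<phi>" "k \<le> 2 ^ n"
  shows "\<phi> (net n k) = \<phi> a + real k / 2 ^ n * (\<phi> b - \<phi> a)"
  using assms(2)
proof (induction n arbitrary: k)
  case 0
  then show ?case by (cases k) auto
next
  case (Suc n)
  have "k div 2 + Suc k div 2 = k" by presburger
  then have k: "real (k div 2) + real (Suc k div 2) = real k" by (metis of_nat_add)
  have "\<phi> (net (Suc n) k) = (\<phi> (net n (k div 2)) + \<phi> (net n (Suc k div 2))) / 2"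
    using linearizes_on_F[OF assms(1) net_in_segment net_in_segment] by (simp add: net.simps(2))
  also have "\<dots> = \<phi> a + (real (k div 2) + real (Suc k div 2)) / 2 ^ Suc n * (\<phi> b - \<phi> a)"
    using Suc.prems by (simp add: Suc.IH add_divide_distrib distrib_right)
  finally show ?case using k by simp
qed

text \<open>After normalization both maps agree on the net, and by monotonicity they send
  \<open>x\<close> into the same dyadic cell at every level.\<close>

lemma linearizes_on_affine:
  assumes "linearizes_on {a..b} \<phi>" "linearizes_on {a..b} \<psi>" "x \<in> {a..b}"
  shows "(\<phi> x - \<phi> a) * (\<psi> b - \<psi> a) = (\<psi> x - \<psi> a) * (\<phi> b - \<phi> a)"
proof -
  let ?r = "\<lambda>\<phi>. (\<phi> x - \<phi> a) / (\<phi> b - \<phi> a)"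
  have pos: "\<phi> b - \<phi> a > 0" if "linearizes_on {a..b} \<phi>" for \<phi>
    using linearizes_on_less[OF that, of a b] a_less_b by simp
  have r: "real k / 2 ^ n \<le> ?r \<phi> \<and> ?r \<phi> \<le> real (Suc k) / 2 ^ n"
    if lin: "linearizes_on {a..b} \<phi>" and k: "k < 2 ^ n" "net n k \<le> x" "x \<le> net n (Suc k)" for \<phi> k n
  proof -
    have "\<phi> (net n k) \<le> \<phi> x" "\<phi> x \<le> \<phi> (net n (Suc k))"
      using linearizes_on_le[OF lin] net_in_segment assms(3) k by blast+
    then have "real k / 2 ^ n * (\<phi> b - \<phi> a) \<le> \<phi> x - \<phi> a"
      "\<phi> x - \<phi> a \<le> real (Suc k) / 2 ^ n * (\<phi> b - \<phi> a)"
      using linearizes_on_net[OF lin, of k n] linearizes_on_net[OF lin, of "Suc k" n] k by simp_all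
    then show ?thesis
      using pos[OF lin] by (simp only: pos_le_divide_eq pos_divide_le_eq)
  qed
  have "?r \<phi> = ?r \<psi>"
  proof (rule eq_if_dyadically_close)
    fix n
    obtain k where "k < 2 ^ n" "net n k \<le> x" "x \<le> net n (Suc k)"
      using net_bracket assms(3) by blast
    then show "\<bar>?r \<phi> - ?r \<psi>\<bar> \<le> 1 / 2 ^ n"
      using r[OF assms(1), of k n] r[OF assms(2), of k n] by (simp add: add_divide_distrib abs_le_iff)
  qed
  then show ?thesis
    using pos[OF assms(1)] pos[OF assms(2)] by (simp add: field_simps)
qed

section \<open>The coordinate function, a linearization of the segment\<close>

text \<open>This is the map \<open>\<psi>\<close> of the overview, given as a Dedekind cut: the
  supremum of the dyadic labels of the net points up to \<open>x\<close>.\<close>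

definition coord :: "real \<Rightarrow> real" where
  "coord x = Sup {real k / 2 ^ n | n k. k \<le> 2 ^ n \<and> net n k \<le> x}"

lemma coord_le:
  assumes "x \<in> {a..b}" "k \<le> 2 ^ n" "x \<le> net n k"
  shows "coord x \<le> real k / 2 ^ n"
  unfolding coord_def
proof (rule cSup_least)
  have "net 0 0 \<le> x" using assms(1) by simp
  then show "{real k / 2 ^ n | n k. k \<le> 2 ^ n \<and> net n k \<le> x} \<noteq> {}" by blast
qed (use assms net_le_imp_dyadic_le in force)

lemma le_coord:
  assumes "k \<le> 2 ^ n" "net n k \<le> x"
  shows "real k / 2 ^ n \<le> coord x"
  unfolding coord_def
proof (rule cSup_upper)
  show "bdd_above {real k / 2 ^ n | n k. k \<le> 2 ^ n \<and> net n k \<le> x}"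
    by (rule bdd_aboveI[of _ 1]) (auto simp: divide_le_eq_1 simp flip: of_nat_le_iff)
qed (use assms in blast)

lemma coord_mono:
  assumes "x \<in> {a..b}" "y \<in> {a..b}" "x \<le> y"
  shows "coord x \<le> coord y"
  unfolding coord_def[of x]
proof (rule cSup_least)
  have "net 0 0 \<le> x" using assms(1) by simp
  then show "{real k / 2 ^ n | n k. k \<le> 2 ^ n \<and> net n k \<le> x} \<noteq> {}" by blast
qed (use assms le_coord in force)

text \<open>If \<open>x\<close> and \<open>y\<close> lie in the cells starting at \<open>k\<close>
  and \<open>l\<close>, then \<open>F x y\<close> lies between the points \<open>k + l\<close> and
  \<open>k + l + 2\<close> of the next level. Hence both sides share an interval of length
  \<open>1 / 2 ^ n\<close>.\<close>

lemma coord_F: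
  assumes "x \<in> {a..b}" "y \<in> {a..b}"
  shows "coord (F x y) = (coord x + coord y) / 2"
proof (rule eq_if_dyadically_close)
  have close: "\<bar>c - (r + s) / 2\<bar> \<le> e"
    if "(K + L) / 2 \<le> c" "c \<le> (K' + L') / 2" "K \<le> r" "r \<le> K'" "L \<le> s" "s \<le> L'"
      "K' = K + e" "L' = L + e" for c e r s K L K' L' :: real
    using that by (simp add: abs_le_iff field_simps)
  fix n
  have xy: "x \<in> I" "y \<in> I" using assms segment_subset a_in b_in by blast+
  obtain k where k: "k < 2 ^ n" "net n k \<le> x" "x \<le> net n (Suc k)"
    using net_bracket assms(1) by blast
  obtain l where l: "l < 2 ^ n" "net n l \<le> y" "y \<le> net n (Suc l)"
    using net_bracket assms(2) by blast
  have "F (net n k) (net n l) \<le> F x y" "F x y \<le> F (net n (Suc k)) (net n (Suc l))"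
    using k l xy net_in by (auto intro!: F_mono)
  then have "net (Suc n) (k + l) \<le> F x y" "F x y \<le> net (Suc n) (Suc k + Suc l)"
    using F_net[of k n l] F_net[of "Suc k" n "Suc l"] k l by simp_all
  then have "real (k + l) / 2 ^ Suc n \<le> coord (F x y)" "coord (F x y) \<le> real (Suc k + Suc l) / 2 ^ Suc n"
    using le_coord[of "k + l" "Suc n"] coord_le[of "F x y" "Suc k + Suc l" "Suc n"]
      F_in_segment[OF a_in b_in assms] k l by simp_all
  then have "(real k / 2 ^ n + real l / 2 ^ n) / 2 \<le> coord (F x y)"
    "coord (F x y) \<le> (real (Suc k) / 2 ^ n + real (Suc l) / 2 ^ n) / 2"
    by (simp_all add: add_divide_distrib)
  moreover have "real k / 2 ^ n \<le> coord x" "coord x \<le> real (Suc k) / 2 ^ n"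
    "real l / 2 ^ n \<le> coord y" "coord y \<le> real (Suc l) / 2 ^ n"
    using k l assms by (auto intro!: le_coord coord_le simp del: of_nat_Suc)
  moreover have "real (Suc k) / 2 ^ n = real k / 2 ^ n + 1 / 2 ^ n"
    "real (Suc l) / 2 ^ n = real l / 2 ^ n + 1 / 2 ^ n"
    by (simp_all add: add_divide_distrib)
  ultimately show "\<bar>coord (F x y) - (coord x + coord y) / 2\<bar> \<le> 1 / 2 ^ n"
    by (rule close)
qed

text \<open>The preimage is the supremum of the net points with label at most \<open>t\<close>. Its
  coordinate and \<open>t\<close> lie in the same dyadic cell, the one starting at
  \<open>k = \<lfloor>t * 2 ^ n\<rfloor>\<close>.\<close>

lemma coord_surj:
  assumes "t \<in> {0..1}"
  obtains x where "x \<in> {a..b}" "coord x = t"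
proof -
  define S where "S = {net n k | n k. k \<le> 2 ^ n \<and> real k / 2 ^ n \<le> t}"
  define x where "x = Sup S"
  have "0 \<le> (2 :: nat) ^ 0 \<and> real 0 / 2 ^ 0 \<le> t" using assms by simp
  then have "net 0 0 \<in> S" unfolding S_def by blast
  moreover have S_sub: "S \<subseteq> {a..b}" unfolding S_def using net_in_segment by blast
  ultimately have aS: "a \<in> S" "S \<noteq> {}" "bdd_above S"
    by (auto intro: bdd_above_mono[OF bdd_above_Icc])
  have x: "x \<in> {a..b}"
    unfolding x_def using cSup_upper[OF aS(1,3)] cSup_least[OF aS(2), of b] S_sub by force
  have "coord x = t"
  proof (rule eq_if_dyadically_close)
    fix n :: nat
    define k where "k = nat \<lfloor>t * 2 ^ n\<rfloor>"
    have k: "real k \<le> t * 2 ^ n" "t * 2 ^ n < real (Suc k)"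
      unfolding k_def using assms real_of_int_floor_add_one_gt[of "t * 2 ^ n"]
      by (auto simp: add.commute)
    have "t * 2 ^ n \<le> 2 ^ n" using assms by simp
    then have "real k \<le> 2 ^ n" using k by linarith
    then have "real k \<le> real (2 ^ n)" by simp
    then have k_le: "k \<le> 2 ^ n" by (simp only: of_nat_le_iff)
    have kt: "real k / 2 ^ n \<le> t" "t < real (Suc k) / 2 ^ n"
      using k by (simp_all add: field_simps)
    have "net n k \<in> S" unfolding S_def using k_le kt by blast
    then have "net n k \<le> x" unfolding x_def using aS by (intro cSup_upper)
    then have 1: "real k / 2 ^ n \<le> coord x" using le_coord k_le by blast
    have 2: "coord x \<le> real (Suc k) / 2 ^ n"
    \<comment> \<open>This happens only for \<open>t = 1\<close>; then \<open>Suc k\<close> exceeds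
      the index range, and the bound comes from \<open>x \<le> b\<close> instead.\<close>
    proof (cases "k = 2 ^ n")
      case True
      have "coord x \<le> real (2 ^ n) / 2 ^ n"
        using x net_top by (intro coord_le) auto
      also have "\<dots> \<le> real (Suc k) / 2 ^ n"
        using True by (intro divide_right_mono) auto
      finally show ?thesis .
    next
      case False
      have "x \<le> net n (Suc k)"
        unfolding x_def
      proof (rule cSup_least[OF aS(2)])
        fix s assume "s \<in> S"
        then obtain m j where s: "s = net m j" "j \<le> 2 ^ m" "real j / 2 ^ m \<le> t"
          unfolding S_def by blast
        show "s \<le> net n (Suc k)"
        proof (rule ccontr)
          assume "\<not> s \<le> net n (Suc k)"
          then have "real (Suc k) / 2 ^ n \<le> real j / 2 ^ m"
            using s k_le False by (intro net_le_imp_dyadic_le) auto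
          then show False using kt s by linarith
        qed
      qed
      then show ?thesis using x k_le False by (intro coord_le) auto
    qed
    show "\<bar>coord x - t\<bar> \<le> 1 / 2 ^ n"
      using 1 2 kt by (simp add: add_divide_distrib abs_le_iff)
  qed
  then show ?thesis using that x by blast
qed

lemma coord_less:
  assumes "u \<in> {a..b}" "v \<in> {a..b}" "u < v"
  shows "coord u < coord v"
proof (rule ccontr)
  assume "\<not> coord u < coord v"
  then have eq: "coord v = coord u" using coord_mono[of u v] assms by simp
  have uv: "u \<in> I" "v \<in> I" using assms segment_subset a_in b_in by blast+
  \<comment> \<open>Each \<open>t\<close> in \<open>[0, 1]\<close> is recovered from a rational
    \<open>r\<close> between \<open>F u z\<close> and \<open>F v z\<close>, where
    \<open>coord z = t\<close>; this would make \<open>[0, 1]\<close> countable.\<close>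
  have "t \<in> (\<lambda>r. 2 * coord r - coord u) ` \<rat>" if "t \<in> {0..1}" for t
  proof -
    obtain z where z: "z \<in> {a..b}" "coord z = t" using coord_surj \<open>t \<in> {0..1}\<close> by blast
    have "F u z < F v z" using F_mono_left uv z segment_subset a_in b_in assms(3) by blast
    then obtain r where r: "r \<in> \<rat>" "F u z < r" "r < F v z" using Rats_dense_in_real by blast
    have seg: "F u z \<in> {a..b}" "F v z \<in> {a..b}" using F_in_segment a_in b_in assms z by blast+
    then have "r \<in> {a..b}" using r by auto
    then have "coord (F u z) \<le> coord r" "coord r \<le> coord (F v z)"
      using seg r by (auto intro!: coord_mono)
    then have "coord r = (coord u + t) / 2"
      using coord_F[OF assms(1) z(1)] coord_F[OF assms(2) z(1)] z(2) eq by simp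
    then have "t = 2 * coord r - coord u" by simp
    then show ?thesis using r(1) by blast
  qed
  then have "{0..1} \<subseteq> (\<lambda>r. 2 * coord r - coord u) ` \<rat>" by blast
  moreover have "countable ((\<lambda>r. 2 * coord r - coord u) ` \<rat>)"
    by (intro countable_image countable_rat)
  ultimately show False
    using countable_subset uncountable_closed_interval[of 0 1] by auto
qed

lemma linearizes_on_coord: "linearizes_on {a..b} coord"
  unfolding linearizes_on_def strict_mono_on_def using coord_less coord_F by blast

text \<open>By uniqueness \<open>\<phi>\<close> is an increasing affine function of
  \<open>coord\<close>, which attains every value in \<open>[0, 1]\<close>.\<close>

lemma linearizes_on_intermediate_value:
  assumes "linearizes_on {a..b} \<phi>" "\<phi> a \<le> t" "t \<le> \<phi> b"
  shows "t \<in> \<phi> ` {a..b}"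
proof -
  have pos: "\<phi> b - \<phi> a > 0"
    using linearizes_on_less[OF assms(1), of a b] a_less_b by simp
  have ab: "a \<in> {a..b}" "b \<in> {a..b}" using a_less_b by auto
  \<comment> \<open>The net of level 0 consists of \<open>a\<close> and \<open>b\<close>, with
    labels 0 and 1.\<close>
  have "0 \<le> coord a" "coord b \<le> 1"
    using le_coord[of 0 0 a] coord_le[of b 1 0] ab by auto
  moreover have "coord a \<le> 0" "1 \<le> coord b"
    using le_coord[of 1 0 b] coord_le[of a 0 0] ab by auto
  ultimately have ends: "coord a = 0" "coord b = 1" by auto
  have "(t - \<phi> a) / (\<phi> b - \<phi> a) \<in> {0..1}" using assms pos by simp
  then obtain x where x: "x \<in> {a..b}" "coord x = (t - \<phi> a) / (\<phi> b - \<phi> a)"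
    using coord_surj by blast
  have "\<phi> x - \<phi> a = coord x * (\<phi> b - \<phi> a)"
    using linearizes_on_affine[OF assms(1) linearizes_on_coord x(1)] ends by simp
  then have "\<phi> x = t" using x pos by simp
  then show ?thesis using x by blast
qed

end

section \<open>Gluing the linearizations and constructing the generator\<close>

context bisymmetric_mean
begin

lemma segmentI: "a \<in> I \<Longrightarrow> b \<in> I \<Longrightarrow> a < b \<Longrightarrow> bisymmetric_mean_segment I F a b"
  by unfold_locales

text \<open>The two maps are related affinely with slope \<open>r\<close>, and agreement at two
  points forces \<open>r = 1\<close> and equal offsets.\<close>

lemma linearizes_on_eq:
  assumes ab: "a \<in> I" "b \<in> I" and lin: "linearizes_on {a..b} \<phi>" "linearizes_on {a..b} \<psi>"
    and pq: "p \<in> {a..b}" "q \<in> {a..b}" "p < q" and eq: "\<phi> p = \<psi> p" "\<phi> q = \<psi> q"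
    and x: "x \<in> {a..b}"
  shows "\<phi> x = \<psi> x"
proof -
  have a_less_b: "a < b" using pq by auto
  interpret bisymmetric_mean_segment I F a b using ab a_less_b by (rule segmentI)
  define r where "r = (\<psi> b - \<psi> a) / (\<phi> b - \<phi> a)"
  have "\<phi> b - \<phi> a > 0"
    using linearizes_on_less[OF lin(1), of a b] a_less_b by simp
  then have r: "\<psi> y - \<psi> a = r * (\<phi> y - \<phi> a)" if "y \<in> {a..b}" for y
    using linearizes_on_affine[OF lin that] unfolding r_def by (simp add: field_simps)
  have "\<psi> q - \<psi> p = r * (\<phi> q - \<phi> p)"
    using r[OF pq(1)] r[OF pq(2)] by (simp add: algebra_simps)
  moreover have "\<phi> p < \<phi> q" using linearizes_on_less lin pq by blast
  ultimately have "r = 1" using eq by simp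
  then show ?thesis using r[OF pq(1)] r[OF x] eq by simp
qed

lemma linearizes_on_normalized:
  assumes "a \<in> I" "b \<in> I" "p \<in> {a..b}" "q \<in> {a..b}" "p < q"
  obtains \<phi> where "linearizes_on {a..b} \<phi>" "\<phi> p = 0" "\<phi> q = 1"
proof -
  have "a < b" using assms by auto
  then interpret bisymmetric_mean_segment I F a b using assms by (intro segmentI)
  define \<phi> where "\<phi> x = (coord x - coord p) / (coord q - coord p)" for x
  have pos: "coord q - coord p > 0" using coord_less assms by simp
  have affine: "((s + t) / 2 - c) / d = ((s - c) / d + (t - c) / d) / 2" if "d > 0" for s t c d :: real
    using that by (simp add: field_simps)
  have "linearizes_on {a..b} \<phi>"
    unfolding linearizes_on_def strict_mono_on_def \<phi>_def
    using pos affine by (auto intro!: divide_strict_right_mono coord_less simp: coord_F)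
  moreover have "\<phi> p = 0" "\<phi> q = 1" using pos unfolding \<phi>_def by auto
  ultimately show ?thesis using that by blast
qed

text \<open>Fixing the values 0 at \<open>p\<close> and 1 at \<open>q\<close> removes the affine
  freedom, so the linearizations of all segments containing both points fit together.\<close>

lemma linearizes_on_whole:
  assumes "p \<in> I" "q \<in> I" "p < q"
  obtains \<Phi> where "linearizes_on I \<Phi>"
proof -
  define N where "N A \<phi> \<longleftrightarrow> linearizes_on A \<phi> \<and> \<phi> p = 0 \<and> \<phi> q = 1" for A \<phi>
  \<comment> \<open>The value at \<open>x\<close> is read off on the smallest segment that contains
    \<open>p\<close>, \<open>q\<close> and \<open>x\<close>.\<close>
  define \<Phi> where "\<Phi> x = (SOME \<phi>. N {min p x..max q x} \<phi>) x" for x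
  have \<Phi>: "\<Phi> x = \<phi> x" if "a \<in> I" "b \<in> I" "a \<le> p" "q \<le> b" "x \<in> {a..b}" "N {a..b} \<phi>" for a b x \<phi>
  proof -
    let ?a = "min p x" and ?b = "max q x"
    have ab: "?a \<in> I" "?b \<in> I" "p \<in> {?a..?b}" "q \<in> {?a..?b}" "x \<in> {?a..?b}" "{?a..?b} \<subseteq> {a..b}"
      using that assms segment_subset[of a b] by (auto simp: min_def max_def)
    have "\<exists>\<phi>. N {?a..?b} \<phi>"
      using linearizes_on_normalized[OF ab(1-4) assms(3)] unfolding N_def by blast
    then have "N {?a..?b} (SOME \<phi>. N {?a..?b} \<phi>)" by (rule someI_ex)
    moreover have "N {?a..?b} \<phi>" using that ab linearizes_on_subset unfolding N_def by blast
    ultimately show ?thesis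
      unfolding \<Phi>_def N_def using linearizes_on_eq[OF ab(1,2) _ _ ab(3,4) assms(3) _ _ ab(5)] by auto
  qed
  have "(x < y \<longrightarrow> \<Phi> x < \<Phi> y) \<and> \<Phi> (F x y) = (\<Phi> x + \<Phi> y) / 2" if xy: "x \<in> I" "y \<in> I" for x y
  proof -
    \<comment> \<open>One segment large enough for \<open>p\<close>, \<open>q\<close>,
      \<open>x\<close> and \<open>y\<close> carries a single \<open>\<phi>\<close> equal to
      \<open>\<Phi>\<close> on it, and both claims transfer.\<close>
    let ?a = "min p (min x y)" and ?b = "max q (max x y)"
    have ab: "?a \<in> I" "?b \<in> I" "p \<in> {?a..?b}" "q \<in> {?a..?b}" "x \<in> {?a..?b}" "y \<in> {?a..?b}"
      using xy assms by (auto simp: min_def max_def)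
    obtain \<phi> where \<phi>: "N {?a..?b} \<phi>"
      using linearizes_on_normalized[OF ab(1-4) assms(3)] unfolding N_def by blast
    then have "\<Phi> z = \<phi> z" if "z \<in> {?a..?b}" for z
      using \<Phi>[OF ab(1,2) _ _ that] by simp
    moreover have "F x y \<in> {?a..?b}" using F_in_segment ab by blast
    moreover have "linearizes_on {?a..?b} \<phi>" using \<phi> unfolding N_def by blast
    ultimately show ?thesis
      using ab(5,6) linearizes_on_less linearizes_on_F by metis
  qed
  then have "linearizes_on I \<Phi>" unfolding linearizes_on_def strict_mono_on_def by blast
  then show ?thesis using that by blast
qed

lemma is_interval_linearizes_on_image:
  assumes "linearizes_on I \<Phi>"
  shows "is_interval (\<Phi> ` I)"
  unfolding is_interval_1
proof (intro ballI allI impI)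
  fix s t c assume "s \<in> \<Phi> ` I" "t \<in> \<Phi> ` I" "s \<le> c \<and> c \<le> t"
  then obtain x y where xy: "x \<in> I" "y \<in> I" "\<Phi> x \<le> c" "c \<le> \<Phi> y" by blast
  show "c \<in> \<Phi> ` I"
  proof (cases "x < y")
    case True
    interpret bisymmetric_mean_segment I F x y using xy True by (intro segmentI)
    have "{x..y} \<subseteq> I" using segment_subset xy by blast
    then show ?thesis
      using linearizes_on_intermediate_value[OF linearizes_on_subset[OF assms]] xy by blast
  next
    case False
    then have "\<Phi> y \<le> \<Phi> x" using linearizes_on_le[OF assms] xy by simp
    then have "c = \<Phi> x" using xy by linarith
    then show ?thesis using xy by blast
  qed
qed

lemma quasi_arithmetic_mean_on:
  assumes "proper_interval I"
  shows "quasi_arithmetic_mean_on I F"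
proof -
  obtain p q where pq: "p \<in> I" "q \<in> I" "p < q"
    using assms unfolding proper_interval_def by (metis linorder_neqE_linordered_idom)
  then obtain \<Phi> where \<Phi>: "linearizes_on I \<Phi>" using linearizes_on_whole by blast
  have inj: "inj_on \<Phi> I"
    using \<Phi> unfolding linearizes_on_def by (blast intro: strict_mono_on_imp_inj_on)
  define J where "J = \<Phi> ` I"
  define f where "f = inv_into I \<Phi>"
  have bij: "bij_betw f J I"
    unfolding f_def J_def using inj by (intro bij_betw_inv_into inj_on_imp_bij_betw)
  have f\<Phi>: "f (\<Phi> x) = x" if "x \<in> I" for x
    unfolding f_def using inj that by simp
  have mono: "strict_mono_on J f"
    unfolding strict_mono_on_def J_def
    \<comment> \<open>By contraposition: if the values of \<open>f\<close> are in weakly reversed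
      order, applying \<open>\<Phi>\<close> reverses the arguments as well.\<close>
    using f\<Phi> linearizes_on_le[OF \<Phi>] by (force simp flip: not_le)
  have img: "f ` J = I" using bij by (simp add: bij_betw_def)
  have inv_f: "inv_into J f x = \<Phi> x" if "x \<in> I" for x
    using bij f\<Phi> that unfolding J_def by (metis bij_betw_inv_into_left imageI)
  have "\<Phi> p \<noteq> \<Phi> q" using linearizes_on_less[OF \<Phi> pq] by simp
  then have "proper_interval J"
    unfolding proper_interval_def J_def using is_interval_linearizes_on_image[OF \<Phi>] pq by blast
  \<comment> \<open>The image of \<open>f\<close> is the interval \<open>I\<close>, so strict
    monotonicity leaves no room for a jump.\<close>
  moreover have "continuous_on J f"
    using mono img interval by (intro strict_mono_on_interval_image_continuous) auto
  moreover have "F x y = f ((inv_into J f x + inv_into J f y) / 2)" if "x \<in> I" "y \<in> I" for x y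
    using that inv_f f\<Phi>[OF F_in] linearizes_on_F[OF \<Phi>] by simp
  ultimately show ?thesis
    unfolding quasi_arithmetic_mean_on_def using mono bij by blast
qed

end

theorem corollary10:
  fixes I :: "real set" and F :: "real \<Rightarrow> real \<Rightarrow> real"
  assumes "proper_interval I"
    and "F \<in> I \<rightarrow> I \<rightarrow> I"
  shows "quasi_arithmetic_mean_on I F \<longleftrightarrow>
    reflexive_map_on I F \<and> partially_strictly_increasing_on I F \<and>
    symmetric_map_on I F \<and> bisymmetric_map_on I F"
proof
  assume "reflexive_map_on I F \<and> partially_strictly_increasing_on I F \<and>
    symmetric_map_on I F \<and> bisymmetric_map_on I F"
  then interpret bisymmetric_mean I F
    using assms
    unfolding reflexive_map_on_def partially_strictly_increasing_on_def symmetric_map_on_def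
      bisymmetric_map_on_def proper_interval_def strict_mono_on_def
    by unfold_locales (blast | fastforce)+
  show "quasi_arithmetic_mean_on I F"
    using assms(1) by (rule quasi_arithmetic_mean_on)
qed (rule quasi_arithmetic_mean_on_properties)

end
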